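(* For every cube $Q\subset\mathbb R^n$, all $1<p<n$ and $p\leq q\leq\frac{np}{n-p}$, with $\alpha=n-\frac qp(n-p)$, and every $C>0$, there exist a Radon measure $\mu$ on $\mathbb R^n$ with $\mu\ll\mathcal L$ and a Lipschitz function $f$ such that \[ \biggl(\int_Q|f-f_Q|^q\,d\mu\biggr)^{\frac1q}>C\biggl(\int_Q|\nabla f|^p\,(\mathrm M_\alpha\mu)^{\frac pq}\,dx\biggr)^{\frac1p}. \]
   Context: $\mathcal L$ is Lebesgue measure on $\mathbb R^n$; $\mu\ll\mathcal L$ means that $\mathcal L(A)=0$ implies $\mu(A)=0$. A cube is a closed axis-parallel cube in $\mathbb R^n$, with side length $\mathrm l(Q)$. $f_Q=\frac1{\mathcal L(Q)}\int_Qf\,dx$. The fractional maximal function is $\mathrm M_\alpha\mu(x)=\sup_{Q\ni x}\mathrm l(Q)^\alpha\frac{\mu(Q)}{\mathcal L(Q)}$, the supremum over all cubes $Q\subset\mathbb R^n$ containing $x$. *)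

theory Defs
  imports "HOL-Analysis.Analysis"
begin

definition cube :: "real ^ 'n \<Rightarrow> real \<Rightarrow> (real ^ 'n) set" where
  "cube a l = cbox a (\<chi> i. a $ i + l)"

text \<open>Real powers on the extended nonnegative reals. Only exponents \<open>r > 0\<close> are meaningful
  here, so that \<open>0\<close> and \<open>\<infinity>\<close> are fixed.\<close>

definition epowr :: "ennreal \<Rightarrow> real \<Rightarrow> ennreal" where
  "epowr x r = (if x = \<infinity> then \<infinity> else ennreal (enn2real x powr r))"

text \<open>Both regularity conditions are automatic on Euclidean space; they are kept because the
  conventions for the term differ in which of them they require.\<close>

definition radon_measure :: "'a::topological_space measure \<Rightarrow> bool" where
  "radon_measure M \<longleftrightarrow>
     sets M = sets borel \<and>
     (\<forall>K. compact K \<longrightarrow> emeasure M K < \<infinity>) \<and>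
     (\<forall>B\<in>sets borel. emeasure M B = (INF U\<in>{U. B \<subseteq> U \<and> open U}. emeasure M U)) \<and>
     (\<forall>B\<in>sets borel. emeasure M B = (SUP K\<in>{K. K \<subseteq> B \<and> compact K}. emeasure M K))"

text \<open>By Rademacher's theorem the default value \<open>0\<close> matters for Lipschitz \<open>f\<close> only on a null set;
  it makes the gradient of a continuous \<open>f\<close> Borel measurable.\<close>

definition gradient :: "('a::euclidean_space \<Rightarrow> real) \<Rightarrow> 'a \<Rightarrow> 'a" where
  "gradient f x = (if \<exists>D. GDERIV f x :> D then (THE D. GDERIV f x :> D) else 0)"

definition average :: "'a::euclidean_space set \<Rightarrow> ('a \<Rightarrow> real) \<Rightarrow> real" where
  "average Q f = (1 / measure lborel Q) * (LINT x:Q|lborel. f x)"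

definition frac_maximal :: "real \<Rightarrow> (real ^ 'n) measure \<Rightarrow> real ^ 'n \<Rightarrow> ennreal" where
  "frac_maximal \<alpha> \<mu> x =
     (SUP (a, l)\<in>{(a, l). 0 < l \<and> x \<in> cube a l}.
        ennreal (l powr \<alpha>) * (emeasure \<mu> (cube a l) / emeasure lborel (cube a l)))"

end

(* Let mu be a probability measure concentrated in a tiny ball around the centre c of Q. Away from
   that ball M_alpha mu(x) is at most a constant times |x - c|^(alpha - n), so by the choice of alpha
   the weight (M_alpha mu)^(p/q) is at most a constant times |x - c|^(p - n). For this weight a point
   has zero p-capacity because p > 1: a logarithmic cutoff that climbs from 0 to 1 over N dyadic
   annuli has energy O(N^(1 - p)), since each annulus contributes O(N^(-p)). The left-hand side stays
   at least 1/2, because the cutoff is 1 on the support of mu and has small average on Q. *)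
theory Submission
  imports Defs "HOL-Probability.Probability_Measure"
begin

section \<open>Gradients of Lipschitz functions\<close>

text \<open>The derivative in the direction of the gradient \<open>D\<close> is
  \<open>D \<bullet> D\<close>, while the difference quotients along \<open>D\<close> are at most
  \<open>L * norm D\<close> in absolute value. A Lipschitz bound near \<open>x\<close> suffices, so
  the constant can be adapted to each point.\<close>

lemma norm_gradient_le_lipschitz:
  fixes f :: "'a::euclidean_space \<Rightarrow> real"
  assumes "open U" "x \<in> U" and lip: "L-lipschitz_on U f"
  shows "norm (gradient f x) \<le> L"
proof (cases "\<exists>D. GDERIV f x :> D")
  case True
  then obtain D where D: "GDERIV f x :> D" by blast
  have unique: "E = D" if "GDERIV f x :> E" for E
  proof -
    have "(\<lambda>h. h \<bullet> E) = (\<lambda>h. h \<bullet> D)"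
      using that D unfolding gderiv_def by (rule has_derivative_unique)
    then show ?thesis by (metis inner_commute vector_eq_rdot)
  qed
  have "(THE D. GDERIV f x :> D) = D"
    using D unique by (rule the_equality)
  then have grad: "gradient f x = D"
    using True by (simp add: gradient_def)
  have "((\<lambda>t. x + t *\<^sub>R D) has_derivative (\<lambda>t. t *\<^sub>R D)) (at 0)"
    by (auto intro!: derivative_eq_intros)
  moreover have "(f has_derivative (\<lambda>h. h \<bullet> D)) (at (x + 0 *\<^sub>R D))"
    using D by (simp add: gderiv_def)
  ultimately have "((\<lambda>t. f (x + t *\<^sub>R D)) has_derivative (\<lambda>t. (t *\<^sub>R D) \<bullet> D)) (at 0)"
    by (rule has_derivative_compose)
  then have "((\<lambda>t. f (x + t *\<^sub>R D)) has_field_derivative (D \<bullet> D)) (at 0)"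
    by (simp add: has_field_derivative_def mult_commute_abs)
  then have "((\<lambda>t. (f (x + t *\<^sub>R D) - f x) / t) \<longlongrightarrow> D \<bullet> D) (at 0)"
    by (simp add: has_field_derivative_iff)
  then have lim: "((\<lambda>t. \<bar>(f (x + t *\<^sub>R D) - f x) / t\<bar>) \<longlongrightarrow> \<bar>D \<bullet> D\<bar>) (at 0)"
    by (rule tendsto_rabs)
  have "((\<lambda>t. x + t *\<^sub>R D) \<longlongrightarrow> x + 0 *\<^sub>R D) (at 0)"
    by (intro tendsto_intros)
  then have "\<forall>\<^sub>F t in at 0. x + t *\<^sub>R D \<in> U"
    using assms(1,2) by (auto intro: topological_tendstoD)
  then have "\<forall>\<^sub>F t in at 0. \<bar>(f (x + t *\<^sub>R D) - f x) / t\<bar> \<le> L * norm D"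
    using eventually_neq_at_within[of 0 0 UNIV]
  proof eventually_elim
    case (elim t)
    have "\<bar>f (x + t *\<^sub>R D) - f x\<bar> \<le> L * (\<bar>t\<bar> * norm D)"
      using lipschitz_onD[OF lip elim(1) assms(2)] by (simp add: dist_norm)
    with elim(2) show ?case by (simp add: abs_divide divide_le_eq mult_ac)
  qed
  then have "\<bar>D \<bullet> D\<bar> \<le> L * norm D"
    by (intro tendsto_upperbound[OF lim]) auto
  then have "norm D * norm D \<le> L * norm D"
    by (simp add: power2_norm_eq_inner flip: power2_eq_square)
  \<comment> \<open>Cancelling \<open>norm D\<close> requires \<open>D \<noteq> 0\<close>; for
    \<open>D = 0\<close> the claim is \<open>0 \<le> L\<close>.\<close>
  then have "norm D \<le> L"
    using lipschitz_on_nonneg[OF lip] by (cases "D = 0") auto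
  with grad show ?thesis by simp
next
  case False
  then show ?thesis
    using lipschitz_on_nonneg[OF lip] by (simp add: gradient_def)
qed

lemma abs_ln_diff_le:
  fixes a b m :: real
  assumes "0 < m" "m \<le> a" "m \<le> b"
  shows "\<bar>ln a - ln b\<bar> \<le> \<bar>a - b\<bar> / m"
proof -
  have *: "ln x - ln y \<le> \<bar>x - y\<bar> / m" if "m \<le> x" "m \<le> y" for x y
  proof -
    have "ln x - ln y \<le> (x - y) / y" using that assms(1) by (intro ln_diff_le) auto
    also have "\<dots> \<le> \<bar>x - y\<bar> / y" using that assms(1) by (intro divide_right_mono) auto
    also have "\<dots> \<le> \<bar>x - y\<bar> / m" using that assms(1) by (intro divide_left_mono) auto
    finally show ?thesis .
  qed
  show ?thesis using *[of a b] *[of b a] assms(2,3) by (auto simp: abs_le_iff abs_minus_commute)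
qed

section \<open>The logarithmic cutoff\<close>

text \<open>The distance is clamped to the interval from \<open>e\<close> to \<open>R\<close>, so
  one formula covers the plateau, the annulus and the exterior. On the annulus the function is
  affine in \<open>ln (dist c x)\<close>, hence every dyadic annulus carries the same share of the
  climb.\<close>

definition log_cutoff :: "'a::metric_space \<Rightarrow> real \<Rightarrow> real \<Rightarrow> 'a \<Rightarrow> real" where
  "log_cutoff c e R x = ln (R / max e (min R (dist c x))) / ln (R / e)"

text \<open>The clamped distance is 1-Lipschitz, and \<open>ln\<close> has Lipschitz constant
  \<open>1 / m\<close> above \<open>m\<close>. Taking \<open>m = e\<close> gives a global constant;
  a larger \<open>m\<close> away from \<open>c\<close> gives the decay of the gradient.\<close>

lemma log_cutoff_lipschitz_on:
  assumes "0 < e" "e < R" "0 < m" and m: "\<And>x. x \<in> U \<Longrightarrow> m \<le> max e (min R (dist c x))"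
  shows "(1 / (m * ln (R / e)))-lipschitz_on U (log_cutoff c e R)"
proof (rule lipschitz_onI)
  have ln0: "0 < ln (R / e)" using assms(1,2) by simp
  show "0 \<le> 1 / (m * ln (R / e))" using ln0 assms(3) by simp
  fix x y assume "x \<in> U" "y \<in> U"
  let ?r = "\<lambda>x. max e (min R (dist c x))"
  have "0 < ?r x" "0 < ?r y" using assms(1) by (auto simp: less_max_iff_disj)
  then have "log_cutoff c e R x - log_cutoff c e R y = (ln (?r y) - ln (?r x)) / ln (R / e)"
    using assms(1,2) by (simp add: log_cutoff_def ln_div diff_divide_distrib[symmetric] del: less_max_iff_disj)
  then have "dist (log_cutoff c e R x) (log_cutoff c e R y) = \<bar>ln (?r y) - ln (?r x)\<bar> / ln (R / e)"
    using ln0 by (simp add: dist_real_def abs_divide)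
  also have "\<dots> \<le> (\<bar>?r y - ?r x\<bar> / m) / ln (R / e)"
    using ln0 \<open>x \<in> U\<close> \<open>y \<in> U\<close> by (intro divide_right_mono abs_ln_diff_le m assms(3)) auto
  also have "\<bar>?r y - ?r x\<bar> \<le> dist x y"
    using dist_triangle[of c x y] dist_triangle[of c y x] by (auto simp: dist_commute)
  finally show "dist (log_cutoff c e R x) (log_cutoff c e R y) \<le> 1 / (m * ln (R / e)) * dist x y"
    using ln0 assms(3) by (simp add: divide_right_mono)
qed

lemma log_cutoff_eq_0: "0 < e \<Longrightarrow> e < R \<Longrightarrow> R \<le> dist c x \<Longrightarrow> log_cutoff c e R x = 0"
  by (simp add: log_cutoff_def)

lemma log_cutoff_eq_1: "0 < e \<Longrightarrow> e < R \<Longrightarrow> dist c x \<le> e \<Longrightarrow> log_cutoff c e R x = 1"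
  by (simp add: log_cutoff_def)

lemma log_cutoff_le_1:
  assumes "0 < e" "e < R" shows "log_cutoff c e R x \<le> 1"
proof -
  have "R / max e (min R (dist c x)) \<le> R / e"
    using assms by (intro divide_left_mono) (auto simp: less_max_iff_disj)
  then have "ln (R / max e (min R (dist c x))) \<le> ln (R / e)"
    using assms by (subst ln_le_cancel_iff) (auto simp: less_max_iff_disj)
  then show ?thesis using assms by (simp add: log_cutoff_def)
qed

text \<open>The factor \<open>2\<close> is not sharp: it comes from the Lipschitz constant on the
  neighbourhood \<open>dist c y > dist c x / 2\<close> of \<open>x\<close>, which avoids differentiating the cutoff.\<close>

lemma norm_gradient_log_cutoff_le:
  fixes c :: "'a::euclidean_space"
  assumes "0 < e" "e < R"
  shows "norm (gradient (log_cutoff c e R) x)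
    \<le> 2 / (dist c x * ln (R / e)) * indicator {x. e \<le> dist c x \<and> dist c x \<le> R} x"
proof -
  have ln0: "0 < ln (R / e)" using assms(1,2) by simp
  have loc0: "norm (gradient (log_cutoff c e R) x) \<le> 0"
    if "open U" "x \<in> U" "\<And>y. y \<in> U \<Longrightarrow> log_cutoff c e R y = k" for U k
  proof (rule norm_gradient_le_lipschitz)
    show "0-lipschitz_on U (log_cutoff c e R)"
      using that(3) by (auto intro!: lipschitz_onI)
  qed (use that in auto)
  \<comment> \<open>The two bounding spheres go into the third case, since the first two use an open
    neighbourhood of \<open>x\<close> on which the cutoff is constant.\<close>
  consider "dist c x < e" | "R < dist c x" | "e \<le> dist c x" "dist c x \<le> R" by linarith
  then show ?thesis
  proof cases
    case 1
    then show ?thesis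
      using loc0[of "ball c e" 1] log_cutoff_eq_1[OF assms, of c] by auto
  next
    case 2
    then show ?thesis
      using loc0[of "- cball c R" 0] log_cutoff_eq_0[OF assms, of c] by auto
  next
    case 3
    define m where "m = dist c x / 2"
    have m: "0 < m" unfolding m_def using 3(1) assms(1) by linarith
    have "norm (gradient (log_cutoff c e R) x) \<le> 1 / (m * ln (R / e))"
    proof (rule norm_gradient_le_lipschitz)
      show "open (- cball c m)" "x \<in> - cball c m" using m by (auto simp: m_def)
      show "(1 / (m * ln (R / e)))-lipschitz_on (- cball c m) (log_cutoff c e R)"
        using assms m 3 by (intro log_cutoff_lipschitz_on) (auto simp: m_def)
    qed
    then show ?thesis using 3 m by (simp add: m_def)
  qed
qed

section \<open>Cubes, balls and finite Borel measures\<close>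

lemma emeasure_cube:
  fixes a :: "real ^ 'n"
  assumes "0 \<le> l"
  shows "emeasure lborel (cube a l) = ennreal (l ^ CARD('n))"
proof -
  have ne: "cube a l \<noteq> {}" using assms by (auto simp: cube_def interval_ne_empty_cart)
  have "measure lborel (cube a l) = l ^ CARD('n)"
    using content_cbox_cart[OF ne[unfolded cube_def]] by (simp add: cube_def)
  moreover have "emeasure lborel (cube a l) = ennreal (measure lborel (cube a l))"
    using emeasure_lborel_cbox_finite[of a "\<chi> i. a $ i + l"]
    by (intro emeasure_eq_ennreal_measure) (simp add: cube_def less_top)
  ultimately show ?thesis by simp
qed

lemma cball_subset_cube:
  fixes c :: "real ^ 'n"
  shows "cball c r \<subseteq> cube (\<chi> i. c $ i - r) (2 * r)"
proof
  fix x assume "x \<in> cball c r"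
  then have "\<bar>(x - c) $ i\<bar> \<le> r" for i
    using component_le_norm_cart[of "x - c" i] by (simp add: dist_norm norm_minus_commute)
  then show "x \<in> cube (\<chi> i. c $ i - r) (2 * r)"
    by (simp add: cube_def mem_box_cart abs_le_iff) (smt (verit))
qed

text \<open>The circumscribed cube bounds the volume. Only the order \<open>r ^ n\<close> matters
  later, so the exact volume of the ball is avoided.\<close>

lemma emeasure_cball_le:
  fixes c :: "real ^ 'n"
  assumes "0 \<le> r"
  shows "emeasure lborel (cball c r) \<le> ennreal ((2 * r) ^ CARD('n))"
proof -
  have "emeasure lborel (cball c r) \<le> emeasure lborel (cube (\<chi> i. c $ i - r) (2 * r))"
    by (intro emeasure_mono cball_subset_cube) (simp add: cube_def)
  then show ?thesis using assms by (simp add: emeasure_cube)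
qed

text \<open>Bounding the Euclidean norm by the sum of the coordinates costs a factor
  \<open>n\<close> instead of its square root, which only affects constants.\<close>

lemma dist_le_of_mem_cube:
  fixes x y :: "real ^ 'n"
  assumes "x \<in> cube a l" "y \<in> cube a l"
  shows "dist x y \<le> real CARD('n) * l"
proof -
  have "norm (x - y) \<le> (\<Sum>i\<in>UNIV. \<bar>(x - y) $ i\<bar>)" by (rule norm_le_l1_cart)
  also have "\<dots> \<le> (\<Sum>i\<in>(UNIV::'n set). l)"
  proof (rule sum_mono)
    fix i
    have "a $ i \<le> x $ i \<and> x $ i \<le> a $ i + l \<and> a $ i \<le> y $ i \<and> y $ i \<le> a $ i + l"
      using assms by (auto simp: cube_def mem_box_cart)
    then show "\<bar>(x - y) $ i\<bar> \<le> l" by (simp add: abs_le_iff)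
  qed
  finally show ?thesis by (simp add: dist_norm)
qed

lemma epowr_ennreal: "0 \<le> b \<Longrightarrow> epowr (ennreal b) r = ennreal (b powr r)"
  by (simp add: epowr_def)

lemma epowr_mono:
  assumes "x \<le> y" "0 < r"
  shows "epowr x r \<le> epowr y r"
proof (cases "y = \<infinity>")
  case False
  with assms have "x \<noteq> \<infinity>" by (auto simp: top_unique)
  moreover have "enn2real x \<le> enn2real y"
    using assms False by (intro enn2real_mono) (auto simp: top.not_eq_extremum)
  ultimately show ?thesis
    using assms False by (auto simp: epowr_def intro!: ennreal_leI powr_mono2)
qed (simp add: epowr_def)

text \<open>Finite Borel measures on a complete second countable metric space are inner and outer
  regular; finiteness on compact sets is immediate.\<close>

lemma radon_measure_finite:
  fixes M :: "'a::euclidean_space measure"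
  assumes "sets M = sets borel" "emeasure M (space M) \<noteq> \<infinity>"
  shows "radon_measure M"
proof -
  interpret finite_measure M using assms(2) by (rule finite_measureI)
  show ?thesis
    unfolding radon_measure_def
    using assms(1) inner_regular[OF assms] outer_regular[OF assms] emeasure_finite
    by (metis top.not_eq_extremum infinity_ennreal_def)
qed

section \<open>Integrals over dyadic annuli\<close>

text \<open>The integrand is at most \<open>s powr - n\<close> on the shell, and the shell lies in a
  ball of volume at most \<open>(4 * s) ^ n\<close>. The powers of \<open>s\<close> cancel: the
  integral is scale invariant.\<close>

lemma nn_integral_dist_powr_shell_le:
  fixes c :: "real ^ 'n"
  assumes "0 < s"
  shows "(\<integral>\<^sup>+x. ennreal (dist c x powr - real CARD('n)) * indicator {x. s \<le> dist c x \<and> dist c x \<le> 2 * s} x \<partial>lborel)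
    \<le> ennreal (4 ^ CARD('n))"
proof -
  have "(\<integral>\<^sup>+x. ennreal (dist c x powr - real CARD('n)) * indicator {x. s \<le> dist c x \<and> dist c x \<le> 2 * s} x \<partial>lborel)
    \<le> (\<integral>\<^sup>+x. ennreal (s powr - real CARD('n)) * indicator (cball c (2 * s)) x \<partial>lborel)"
    using assms by (intro nn_integral_mono) (auto simp: indicator_def intro!: ennreal_leI powr_mono2')
  also have "\<dots> = ennreal (s powr - real CARD('n)) * emeasure lborel (cball c (2 * s))"
    by (intro nn_integral_cmult_indicator) simp
  also have "\<dots> \<le> ennreal (s powr - real CARD('n)) * ennreal ((2 * (2 * s)) ^ CARD('n))"
    using assms by (intro mult_left_mono emeasure_cball_le) auto
  also have "\<dots> = ennreal (4 ^ CARD('n))"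
    using assms by (simp add: powr_minus powr_realpow power_mult_distrib flip: ennreal_mult)
  finally show ?thesis .
qed

text \<open>The annulus is a union of \<open>Suc N\<close> dyadic shells, each contributing at most
  the same constant; the induction adds the innermost one. Neighbouring closed shells share a
  sphere, which is harmless for an upper bound.\<close>

lemma nn_integral_dist_powr_annulus_le:
  fixes c :: "real ^ 'n"
  assumes "0 < R"
  shows "(\<integral>\<^sup>+x. ennreal (dist c x powr - real CARD('n))
      * indicator {x. R / 2 ^ Suc N \<le> dist c x \<and> dist c x \<le> R} x \<partial>lborel)
    \<le> ennreal (real (Suc N) * 4 ^ CARD('n))"
proof (induction N)
  case 0
  show ?case using nn_integral_dist_powr_shell_le[of "R / 2" c] assms by simp
next
  case (Suc N)
  let ?g = "\<lambda>x. ennreal (dist c x powr - real CARD('n))"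
  let ?A = "\<lambda>s t. {x. s \<le> dist c x \<and> dist c x \<le> t}"
  let ?s = "R / 2 ^ Suc (Suc N)"
  have [measurable]: "?A s t \<in> sets borel" for s t by measurable
  have "(\<integral>\<^sup>+x. ?g x * indicator (?A ?s R) x \<partial>lborel)
    \<le> (\<integral>\<^sup>+x. ?g x * indicator (?A ?s (2 * ?s)) x + ?g x * indicator (?A (R / 2 ^ Suc N) R) x \<partial>lborel)"
    by (intro nn_integral_mono) (auto simp: indicator_def)
  also have "\<dots> = (\<integral>\<^sup>+x. ?g x * indicator (?A ?s (2 * ?s)) x \<partial>lborel)
      + (\<integral>\<^sup>+x. ?g x * indicator (?A (R / 2 ^ Suc N) R) x \<partial>lborel)"
    by (intro nn_integral_add) measurable
  also have "\<dots> \<le> ennreal (4 ^ CARD('n)) + ennreal (real (Suc N) * 4 ^ CARD('n))"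
    using assms by (intro add_mono Suc.IH nn_integral_dist_powr_shell_le) simp
  also have "\<dots> = ennreal (real (Suc (Suc N)) * 4 ^ CARD('n))"
    by (simp add: algebra_simps flip: ennreal_plus)
  finally show ?case .
qed

section \<open>The maximal function, the weighted energy and the average\<close>

text \<open>Only cubes that meet the small ball carry mass, and such a cube can contain
  \<open>x\<close> only if its side length is comparable to \<open>dist c x\<close> or
  larger.\<close>

lemma frac_maximal_le:
  fixes c :: "real ^ 'n"
  assumes total: "\<And>B. emeasure \<mu> B \<le> 1"
    and supp: "\<And>B. B \<in> sets borel \<Longrightarrow> B \<inter> ball c (e / 2) = {} \<Longrightarrow> emeasure \<mu> B = 0"
    and "0 < e" "e \<le> dist c x" "\<alpha> \<le> real CARD('n)"
  shows "frac_maximal \<alpha> \<mu> x \<le> ennreal ((dist c x / (2 * real CARD('n))) powr (\<alpha> - real CARD('n)))"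
  unfolding frac_maximal_def
proof (rule SUP_least, clarify)
  fix b :: "real ^ 'n" and l :: real
  assume l: "0 < l" and x: "x \<in> cube b l"
  let ?n = "real CARD('n)"
  show "ennreal (l powr \<alpha>) * (emeasure \<mu> (cube b l) / emeasure lborel (cube b l))
    \<le> ennreal ((dist c x / (2 * ?n)) powr (\<alpha> - ?n))"
  proof (cases "cube b l \<inter> ball c (e / 2) = {}")
    case True
    then have "emeasure \<mu> (cube b l) = 0" by (intro supp) (simp_all add: cube_def)
    then show ?thesis by simp
  next
    case False
    then obtain y where y: "y \<in> cube b l" "dist c y < e / 2" by auto
    \<comment> \<open>The radius \<open>e / 2\<close> is at most half of \<open>dist c x\<close>, so
      the cube has to bridge the other half.\<close>
    have "dist c x \<le> dist c y + dist x y" by (metis dist_commute dist_triangle)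
    also have "\<dots> \<le> dist c x / 2 + ?n * l"
      using y assms(4) dist_le_of_mem_cube[OF x y(1)] by simp
    finally have lower: "dist c x / (2 * ?n) \<le> l" by (simp add: field_simps)
    \<comment> \<open>Mass at most 1 and volume \<open>l ^ n\<close> leave the power
      \<open>\<alpha> - n\<close> of \<open>l\<close>. It is not positive, so the smallest
      admissible \<open>l\<close> is the worst.\<close>
    have "ennreal (l powr \<alpha>) * (emeasure \<mu> (cube b l) / emeasure lborel (cube b l))
      \<le> ennreal (l powr \<alpha>) * (1 / ennreal (l ^ CARD('n)))"
      using l by (intro mult_left_mono) (auto simp: emeasure_cube intro!: divide_right_mono_ennreal total)
    also have "\<dots> = ennreal (l powr (\<alpha> - ?n))"
      using l by (simp add: divide_ennreal powr_diff powr_realpow flip: ennreal_1 ennreal_mult)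
    also have "\<dots> \<le> ennreal ((dist c x / (2 * ?n)) powr (\<alpha> - ?n))"
      using assms lower by (intro ennreal_leI powr_mono2') (auto intro!: divide_pos_pos simp del: zero_less_dist_iff)
    finally show ?thesis .
  qed
qed


text \<open>At distance \<open>r\<close> from \<open>c\<close> the gradient is of order at most
  \<open>1 / (r * Suc N)\<close> and the weight of order at most \<open>r powr (p - n)\<close>.
  Their product has the scale-invariant factor \<open>r powr - n\<close>, and integrating it over
  \<open>Suc N\<close> shells turns \<open>Suc N powr - p\<close> into
  \<open>Suc N powr (1 - p)\<close>.\<close>

lemma weighted_energy_log_cutoff_le:
  fixes c :: "real ^ 'n"
  assumes total: "\<And>B. emeasure \<mu> B \<le> 1"
    and supp: "\<And>B. B \<in> sets borel \<Longrightarrow> B \<inter> ball c (e / 2) = {} \<Longrightarrow> emeasure \<mu> B = 0"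
    and R: "0 < R" and e: "e = R / 2 ^ Suc N"
    and p: "0 < p" "p \<le> real CARD('n)" and q: "0 < q"
    and \<alpha>: "\<alpha> = real CARD('n) - q / p * (real CARD('n) - p)"
  shows "(\<integral>\<^sup>+x\<in>Q. ennreal (norm (gradient (log_cutoff c e R) x) powr p)
                  * epowr (frac_maximal \<alpha> \<mu> x) (p / q) \<partial>lborel)
    \<le> ennreal ((2 / ln 2) powr p * (2 * real CARD('n)) powr (real CARD('n) - p) * 4 ^ CARD('n)
        * real (Suc N) powr (1 - p))"
proof -
  let ?n = "real CARD('n)"
  let ?A = "{x. e \<le> dist c x \<and> dist c x \<le> R}"
  let ?K = "(2 / ln 2) powr p * (2 * ?n) powr (?n - p) * real (Suc N) powr - p"
  have n: "0 < ?n" by simp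
  have "1 < (2::real) ^ Suc N" by (rule one_less_power) auto
  then have e0: "0 < e" "e < R" using R by (auto simp: e field_simps)
  have "ln (R / e) = ln (2 ^ Suc N)" using R by (simp add: e)
  then have T: "ln (R / e) = real (Suc N) * ln 2" by (simp add: ln_realpow del: power_Suc)
  have \<alpha>n: "\<alpha> \<le> ?n" using p q by (simp add: \<alpha>)
  \<comment> \<open>The value of \<open>\<alpha>\<close> is chosen for this identity: the power
    \<open>p / q\<close> of the maximal bound no longer depends on \<open>q\<close>.\<close>
  have exponent: "(\<alpha> - ?n) * (p / q) = p - ?n" using p q by (simp add: \<alpha> field_simps)
  have [measurable]: "?A \<in> sets borel" by measurable
  have pointwise: "ennreal (norm (gradient (log_cutoff c e R) x) powr p) * epowr (frac_maximal \<alpha> \<mu> x) (p / q)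
      \<le> ennreal ?K * (ennreal (dist c x powr - ?n) * indicator ?A x)" for x
  proof (cases "x \<in> ?A")
    \<comment> \<open>Near \<open>c\<close> the maximal function is not controlled, but the gradient
      vanishes there, and in \<open>ennreal\<close> a zero factor annihilates even
      \<open>\<infinity>\<close>.\<close>
    case False
    then have "gradient (log_cutoff c e R) x = 0"
      using norm_gradient_log_cutoff_le[OF e0, of c x] by auto
    then show ?thesis by simp
  next
    case True
    define r where "r = dist c x"
    have r: "e \<le> r" "0 < r" using True e0 by (auto simp: r_def)
    have "frac_maximal \<alpha> \<mu> x \<le> ennreal ((r / (2 * ?n)) powr (\<alpha> - ?n))"
      unfolding r_def using total supp e0(1) True \<alpha>n by (intro frac_maximal_le[of \<mu> c e]) auto
    then have "epowr (frac_maximal \<alpha> \<mu> x) (p / q) \<le> epowr (ennreal ((r / (2 * ?n)) powr (\<alpha> - ?n))) (p / q)"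
      using p q by (intro epowr_mono) auto
    also have "\<dots> = ennreal ((r / (2 * ?n)) powr (p - ?n))"
      by (simp only: epowr_ennreal[OF powr_ge_zero] powr_powr exponent)
    finally have M: "epowr (frac_maximal \<alpha> \<mu> x) (p / q) \<le> ennreal ((r / (2 * ?n)) powr (p - ?n))" .
    have "norm (gradient (log_cutoff c e R) x) \<le> 2 / (r * (real (Suc N) * ln 2))"
      using norm_gradient_log_cutoff_le[OF e0, of c x] True by (simp add: r_def T)
    then have G: "norm (gradient (log_cutoff c e R) x) powr p \<le> (2 / (r * (real (Suc N) * ln 2))) powr p"
      using p by (intro powr_mono2) auto
    \<comment> \<open>Regrouping isolates the dependence on \<open>N\<close> and leaves a power of
      \<open>r\<close> that cancels \<open>r powr p\<close> from the weight.\<close>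
    have "2 / (r * (real (Suc N) * ln 2)) = (2 / ln 2) / (real (Suc N) * r)"
      by (simp add: mult_ac)
    then have "(2 / (r * (real (Suc N) * ln 2))) powr p
        = (2 / ln 2) powr p / (real (Suc N) powr p * r powr p)"
      using r by (simp add: powr_divide powr_mult del: of_nat_Suc)
    moreover have "(r / (2 * ?n)) powr (p - ?n) = r powr p * r powr - ?n * (2 * ?n) powr (?n - p)"
      using r n powr_minus_divide[of "2 * ?n" "?n - p"]
      by (simp add: powr_divide powr_diff powr_minus_divide)
    ultimately have "(2 / (r * (real (Suc N) * ln 2))) powr p * (r / (2 * ?n)) powr (p - ?n) = ?K * r powr - ?n"
      using r by (simp add: powr_minus_divide del: of_nat_Suc)
    then have "ennreal ((2 / (r * (real (Suc N) * ln 2))) powr p) * ennreal ((r / (2 * ?n)) powr (p - ?n))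
      = ennreal ?K * ennreal (r powr - ?n)"
      by (simp flip: ennreal_mult)
    moreover have "ennreal (norm (gradient (log_cutoff c e R) x) powr p) * epowr (frac_maximal \<alpha> \<mu> x) (p / q)
      \<le> ennreal ((2 / (r * (real (Suc N) * ln 2))) powr p) * ennreal ((r / (2 * ?n)) powr (p - ?n))"
      using G M by (intro mult_mono ennreal_leI) auto
    ultimately show ?thesis using True by (simp add: r_def)
  qed
  have "(\<integral>\<^sup>+x\<in>Q. ennreal (norm (gradient (log_cutoff c e R) x) powr p)
                  * epowr (frac_maximal \<alpha> \<mu> x) (p / q) \<partial>lborel)
    \<le> (\<integral>\<^sup>+x. ennreal ?K * (ennreal (dist c x powr - ?n) * indicator ?A x) \<partial>lborel)"
    using pointwise by (intro nn_integral_mono) (simp add: indicator_def)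
  also have "\<dots> = ennreal ?K * (\<integral>\<^sup>+x. ennreal (dist c x powr - ?n) * indicator ?A x \<partial>lborel)"
    by (intro nn_integral_cmult) measurable
  also have "\<dots> \<le> ennreal ?K * ennreal (real (Suc N) * 4 ^ CARD('n))"
    unfolding e by (intro mult_left_mono nn_integral_dist_powr_annulus_le R) auto
  also have "\<dots> = ennreal (?K * (real (Suc N) * 4 ^ CARD('n)))"
    by (intro ennreal_mult[symmetric]) auto
  also have "?K * (real (Suc N) * 4 ^ CARD('n))
    = (2 / ln 2) powr p * (2 * ?n) powr (?n - p) * 4 ^ CARD('n) * real (Suc N) powr (1 - p)"
    by (simp add: powr_diff powr_minus_divide del: of_nat_Suc)
  finally show ?thesis .
qed

text \<open>The cutoff is at most 1 and vanishes off the ball of radius \<open>l / 4\<close>. This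
  ball fits into a cube of side \<open>l / 2\<close>, which occupies the fraction
  \<open>(1 / 2) ^ n\<close> of the volume, at most one half as \<open>n \<ge> 1\<close>.\<close>

lemma average_log_cutoff_le:
  fixes a :: "real ^ 'n"
  assumes "0 < l" and c: "c = (\<chi> i. a $ i + l / 2)" and "0 < e" "e < l / 4"
  shows "average (cube a l) (log_cutoff c e (l / 4)) \<le> 1 / 2"
proof -
  let ?f = "log_cutoff c e (l / 4)"
  let ?B = "cball c (l / 4)"
  have bound: "indicator (cube a l) x *\<^sub>R ?f x \<le> indicator ?B x" for x
    using log_cutoff_le_1[OF assms(3,4), of c x] log_cutoff_eq_0[OF assms(3,4), of c x]
    by (auto simp: indicator_def)
  have int: "integrable lborel (indicator ?B :: real ^ 'n \<Rightarrow> real)"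
    using emeasure_lborel_cball_finite[of c "l / 4"] by (simp add: less_top)
  have "(LINT x:cube a l|lborel. ?f x) \<le> (LINT x|lborel. indicator ?B x)"
    unfolding set_lebesgue_integral_def
    using int bound by (rule integral_mono') simp
  also have "\<dots> = measure lborel ?B" by simp
  also have "\<dots> \<le> (2 * (l / 4)) ^ CARD('n)"
    using emeasure_cball_le[of "l / 4" c] assms(1)
    by (simp add: measure_def enn2real_leI)
  also have "\<dots> = l ^ CARD('n) * (1 / 2) ^ CARD('n)" by (simp add: power_divide)
  also have "(1 / 2 :: real) ^ CARD('n) \<le> (1 / 2) ^ 1"
    by (intro power_decreasing) (simp_all add: Suc_leI)
  finally have "(LINT x:cube a l|lborel. ?f x) \<le> l ^ CARD('n) * (1 / 2)"
    using assms(1) by simp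
  moreover have "measure lborel (cube a l) = l ^ CARD('n)"
    using assms(1) by (simp add: measure_def emeasure_cube)
  ultimately show ?thesis using assms(1) by (simp add: average_def field_simps)
qed

section \<open>Construction of the counterexample\<close>

theorem mainTheorem7:
  fixes a :: "real ^ 'n" and l p q \<alpha> C :: real and Q :: "(real ^ 'n) set"
  assumes "0 < l" and "Q = cube a l"
    and "1 < p" and "p < real CARD('n)"
    and "p \<le> q" and "q \<le> real CARD('n) * p / (real CARD('n) - p)"
    and "\<alpha> = real CARD('n) - q / p * (real CARD('n) - p)"
    and "0 < C"
  shows "\<exists>(\<mu> :: (real ^ 'n) measure) (f :: real ^ 'n \<Rightarrow> real).
     radon_measure \<mu> \<and> absolutely_continuous lborel \<mu> \<and>
     (\<exists>L. L-lipschitz_on UNIV f) \<and>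
     epowr (\<integral>\<^sup>+x\<in>Q. ennreal (\<bar>f x - average Q f\<bar> powr q) \<partial>\<mu>) (1 / q)
       > ennreal C *
         epowr (\<integral>\<^sup>+x\<in>Q. ennreal (norm (gradient f x) powr p)
                         * epowr (frac_maximal \<alpha> \<mu> x) (p / q) \<partial>lborel) (1 / p)"
proof -
  let ?n = "real CARD('n)"
  define K where "K = (2 / ln 2) powr p * (2 * ?n) powr (?n - p) * 4 ^ CARD('n)"
  have K: "0 \<le> K" by (simp add: K_def)
  \<comment> \<open>Here \<open>p > 1\<close> makes the energy bound tend to 0. The threshold
    \<open>(1 / (2 * C)) powr p\<close> is what brings \<open>C\<close> times the
    \<open>p\<close>-th root below 1/2.\<close>
  have "filterlim (\<lambda>N. real (Suc N)) at_top sequentially"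
    using filterlim_real_sequentially by (rule filterlim_compose[OF _ filterlim_Suc])
  then have "(\<lambda>N. real (Suc N) powr (1 - p)) \<longlonglongrightarrow> 0"
    using assms(3) by (intro tendsto_neg_powr) auto
  then have "(\<lambda>N. K * real (Suc N) powr (1 - p)) \<longlonglongrightarrow> 0" by (rule tendsto_mult_right_zero)
  then have "\<forall>\<^sub>F N in sequentially. K * real (Suc N) powr (1 - p) < (1 / (2 * C)) powr p"
    using assms(8) by (intro order_tendstoD) auto
  then obtain N where N: "K * real (Suc N) powr (1 - p) < (1 / (2 * C)) powr p"
    by (meson eventually_sequentially order_refl)
  define c where "c = (\<chi> i. a $ i + l / 2)"
  \<comment> \<open>This radius keeps the average over \<open>Q\<close> at most 1/2, and the choice
    of \<open>e\<close> yields exactly \<open>Suc N\<close> dyadic annuli between \<open>e\<close>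
    and \<open>R\<close>.\<close>
  define R where "R = l / 4"
  define e where "e = R / 2 ^ Suc N"
  define f where "f = log_cutoff c e R"
  \<comment> \<open>Normalised Lebesgue measure on a ball is absolutely continuous with mass 1. Half
    the radius \<open>e\<close> separates it from the annulus where the gradient lives, as the
    maximal estimate requires.\<close>
  define \<mu> where "\<mu> = uniform_measure lborel (ball c (e / 2))"
  have "1 < (2::real) ^ Suc N" by (rule one_less_power) auto
  then have e0: "0 < e" "e < R" using assms(1) by (auto simp: e_def R_def field_simps)
  have ball: "emeasure lborel (ball c (e / 2)) \<noteq> 0" "emeasure lborel (ball c (e / 2)) \<noteq> \<infinity>"
    using e0 emeasure_lborel_ball_finite[of c "e / 2"] content_ball_pos[of "e / 2" c]
    by (auto simp: measure_def less_top)
  have sets: "sets \<mu> = sets borel" by (simp add: \<mu>_def)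
  have em: "emeasure \<mu> B = emeasure lborel (ball c (e / 2) \<inter> B) / emeasure lborel (ball c (e / 2))"
    if "B \<in> sets borel" for B
    using that by (simp add: \<mu>_def)
  interpret prob_space \<mu> unfolding \<mu>_def using ball by (rule prob_space_uniform_measure)
  have radon: "radon_measure \<mu>" using sets by (intro radon_measure_finite) (simp_all add: emeasure_space_1)
  have abs_cont: "absolutely_continuous lborel \<mu>"
    unfolding \<mu>_def uniform_measure_def by (intro absolutely_continuousI_density borel_measurable_divide_ennreal borel_measurable_indicator) simp_all
  have lip: "(1 / (e * ln (R / e)))-lipschitz_on UNIV f"
    unfolding f_def using e0 by (intro log_cutoff_lipschitz_on) auto
  have rhs: "ennreal C * epowr (\<integral>\<^sup>+x\<in>Q. ennreal (norm (gradient f x) powr p)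
                         * epowr (frac_maximal \<alpha> \<mu> x) (p / q) \<partial>lborel) (1 / p) < ennreal (1 / 2)"
  proof -
    have "(\<integral>\<^sup>+x\<in>Q. ennreal (norm (gradient f x) powr p) * epowr (frac_maximal \<alpha> \<mu> x) (p / q) \<partial>lborel)
        \<le> ennreal (K * real (Suc N) powr (1 - p))"
      unfolding f_def K_def
    proof (rule weighted_energy_log_cutoff_le)
      show "emeasure \<mu> B \<le> 1" for B by (rule emeasure_le_1)
      show "emeasure \<mu> B = 0" if "B \<in> sets borel" "B \<inter> ball c (e / 2) = {}" for B
        using em[OF that(1)] that(2) by (simp add: Int_commute)
    qed (use assms e0 in \<open>auto simp: e_def\<close>)
    then have "epowr (\<integral>\<^sup>+x\<in>Q. ennreal (norm (gradient f x) powr p)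
          * epowr (frac_maximal \<alpha> \<mu> x) (p / q) \<partial>lborel) (1 / p)
        \<le> epowr (ennreal (K * real (Suc N) powr (1 - p))) (1 / p)"
      using assms(3) by (intro epowr_mono) auto
    also have "\<dots> = ennreal ((K * real (Suc N) powr (1 - p)) powr (1 / p))"
      using K by (simp add: epowr_ennreal)
    finally have "ennreal C * epowr (\<integral>\<^sup>+x\<in>Q. ennreal (norm (gradient f x) powr p)
          * epowr (frac_maximal \<alpha> \<mu> x) (p / q) \<partial>lborel) (1 / p)
        \<le> ennreal (C * (K * real (Suc N) powr (1 - p)) powr (1 / p))"
      using assms(8) by (simp add: ennreal_mult mult_left_mono)
    also have "(K * real (Suc N) powr (1 - p)) powr (1 / p) < ((1 / (2 * C)) powr p) powr (1 / p)"
      using N K assms(3) by (intro powr_less_mono2) auto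
    then have "C * (K * real (Suc N) powr (1 - p)) powr (1 / p) < 1 / 2"
      using assms(3,8) by (simp add: powr_powr field_simps)
    then have "ennreal (C * (K * real (Suc N) powr (1 - p)) powr (1 / p)) < ennreal (1 / 2)"
      using assms(8) by (intro ennreal_lessI) auto
    finally show ?thesis .
  qed
  \<comment> \<open>On the ball carrying \<open>\<mu>\<close> the function equals 1, at least 1/2
    above its average. Since the ball lies in \<open>Q\<close> and has \<open>\<mu>\<close>-mass 1,
    the integral is at least \<open>(1 / 2) powr q\<close>, and the root removes
    \<open>q\<close>.\<close>
  have lhs: "ennreal (1 / 2) \<le> epowr (\<integral>\<^sup>+x\<in>Q. ennreal (\<bar>f x - average Q f\<bar> powr q) \<partial>\<mu>) (1 / q)"
  proof -
    have q: "0 < q" using assms(3,5) by simp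
    have avg: "average Q f \<le> 1 / 2"
      using average_log_cutoff_le[OF assms(1) c_def, of e] e0 by (simp add: assms(2) f_def R_def)
    have "ball c (e / 2) \<subseteq> Q"
    proof
      fix x assume "x \<in> ball c (e / 2)"
      then have "\<bar>(x - c) $ i\<bar> \<le> l / 2" for i
        using component_le_norm_cart[of "x - c" i] e0 assms(1)
        by (simp add: dist_norm norm_minus_commute R_def)
      then show "x \<in> Q"
        by (simp add: assms(2) c_def cube_def mem_box_cart abs_le_iff) (smt (verit) field_sum_of_halves)
    qed
    then have "ennreal ((1 / 2) powr q) * indicator (ball c (e / 2)) x
        \<le> ennreal (\<bar>f x - average Q f\<bar> powr q) * indicator Q x" for x
      using log_cutoff_eq_1[OF e0, of c x] avg e0 q
      by (auto simp: indicator_def f_def intro!: ennreal_leI powr_mono2)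
    then have "(\<integral>\<^sup>+x. ennreal ((1 / 2) powr q) * indicator (ball c (e / 2)) x \<partial>\<mu>)
        \<le> (\<integral>\<^sup>+x\<in>Q. ennreal (\<bar>f x - average Q f\<bar> powr q) \<partial>\<mu>)"
      by (intro nn_integral_mono) auto
    moreover have "(\<integral>\<^sup>+x. ennreal ((1 / 2) powr q) * indicator (ball c (e / 2)) x \<partial>\<mu>)
        = ennreal ((1 / 2) powr q)"
      using ball by (subst nn_integral_cmult_indicator) (simp_all add: \<mu>_def emeasure_uniform_measure_1 del: emeasure_uniform_measure)
    ultimately have "epowr (ennreal ((1 / 2) powr q)) (1 / q)
        \<le> epowr (\<integral>\<^sup>+x\<in>Q. ennreal (\<bar>f x - average Q f\<bar> powr q) \<partial>\<mu>) (1 / q)"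
      using q by (intro epowr_mono) auto
    then show ?thesis using q by (simp add: epowr_ennreal powr_powr)
  qed
  show ?thesis
    using radon abs_cont lip order_less_le_trans[OF rhs lhs] by (intro exI conjI)
qed

end
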